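(* Let $(X,T)$ be a non-trivial weakly mixing dynamical system. Then $(X,T)$ is $n$-tuplewise IP-sensitive for all $n\geq 2$.
   Context: A dynamical system is a pair $(X,T)$ where $X$ is a compact metric space with metric $d$ and $T\colon X\to X$ is a continuous surjection; it is non-trivial if $X$ is not a singleton. $\mathbb{N}$ is the set of positive integers. For a point $x$, $\omega(x,T)$ denotes the set of limit points of the sequence $(T^kx)_{k\ge 1}$, i.e. of all limits of $T^{k_i}x$ with $k_i\to\infty$. A system $(X,T)$ is transitive if there is $x\in X$ with $\omega(x,T)=X$; it is weakly mixing if the product system $(X\times X,T\times T)$ is transitive. A set $F\subset\mathbb{N}$ is an IP-set if there is a sequence $(p_i)_{i\ge1}$ in $\mathbb{N}$ such that $\sum_{i\in\alpha}p_i\in F$ for every non-empty finite $\alpha\subset\mathbb{N}$. For $n\ge2$, $(X,T)$ is $n$-tuplewise IP-sensitive if there is a constant $\delta>0$ such that for every non-empty open $U\subset X$ there exist $x_1,\dots,x_n\in U$ such that $\{k\in\mathbb{N}: \min_{1\le i<j\le n}d(T^kx_i,T^kx_j)>\delta\}$ is an IP-set. *)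

theory Defs
  imports "HOL-Analysis.Analysis"
begin

text \<open>A system is a compact subset \<open>X\<close> of a metric space type, with the restricted metric, together
  with a map \<open>T\<close> of which only the values on \<open>X\<close> matter.\<close>

definition dynamical_system :: "'a::metric_space set \<Rightarrow> ('a \<Rightarrow> 'a) \<Rightarrow> bool" where
  "dynamical_system X T \<longleftrightarrow> compact X \<and> continuous_on X T \<and> T ` X = X"

definition omega_limit :: "'a::metric_space \<Rightarrow> ('a \<Rightarrow> 'a) \<Rightarrow> 'a set" where
  "omega_limit x T =
     {y. \<exists>k :: nat \<Rightarrow> nat. filterlim k at_top sequentially \<and> (\<lambda>i. (T ^^ k i) x) \<longlonglongrightarrow> y}"

text \<open>For \<open>X\<close> compact and invariant, orbit limits taken in the ambient type lie in \<open>X\<close>, so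
  \<open>omega_limit\<close> need not be intersected with \<open>X\<close>.\<close>

definition transitive_system :: "'a::metric_space set \<Rightarrow> ('a \<Rightarrow> 'a) \<Rightarrow> bool" where
  "transitive_system X T \<longleftrightarrow> (\<exists>x\<in>X. omega_limit x T = X)"

definition weakly_mixing :: "'a::metric_space set \<Rightarrow> ('a \<Rightarrow> 'a) \<Rightarrow> bool" where
  "weakly_mixing X T \<longleftrightarrow> transitive_system (X \<times> X) (map_prod T T)"

definition IP_set :: "nat set \<Rightarrow> bool" where
  "IP_set F \<longleftrightarrow> F \<subseteq> {1..} \<and>
     (\<exists>p :: nat \<Rightarrow> nat. (\<forall>i\<ge>1. p i \<ge> 1) \<and>
        (\<forall>\<alpha>. finite \<alpha> \<and> \<alpha> \<noteq> {} \<and> \<alpha> \<subseteq> {1..} \<longrightarrow> (\<Sum>i\<in>\<alpha>. p i) \<in> F))"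

text \<open>Only meaningful for \<open>n \<ge> 2\<close>: otherwise the minimum is over the empty set.\<close>

definition tuplewise_IP_sensitive :: "nat \<Rightarrow> 'a::metric_space set \<Rightarrow> ('a \<Rightarrow> 'a) \<Rightarrow> bool" where
  "tuplewise_IP_sensitive n X T \<longleftrightarrow>
     (\<exists>\<delta>>0. \<forall>U. openin (top_of_set X) U \<and> U \<noteq> {} \<longrightarrow>
        (\<exists>x :: nat \<Rightarrow> 'a. (\<forall>i\<in>{1..n}. x i \<in> U) \<and>
           IP_set {k. k \<ge> 1 \<and>
             Min {dist ((T ^^ k) (x i)) ((T ^^ k) (x j)) | i j. 1 \<le> i \<and> i < j \<and> j \<le> n} > \<delta>}))"

end

theory Submission
  imports Defs
begin

text \<open>By Furstenberg's intersection lemma, weak mixing provides a common return time for finitely many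
  pairs of non-empty open sets. Fix small neighbourhoods \<open>W\<^sub>i\<close> of \<open>n\<close> distinct points. Starting from
  \<open>V\<^sub>i = W\<^sub>i\<close> and \<open>A\<^sub>i\<close> a small ball in \<open>U\<close>, choose successively \<open>p\<close> such that all the sets
  \<open>V\<^sub>i \<inter> T\<^sup>-\<^sup>p V\<^sub>i\<close> and \<open>A\<^sub>i \<inter> T\<^sup>-\<^sup>p V\<^sub>i\<close> are non-empty, and replace \<open>V\<^sub>i\<close> and \<open>A\<^sub>i\<close> by them.
  A point in the closures of all the \<open>A\<^sub>i\<close> is moved into the closure of \<open>W\<^sub>i\<close> by every finite sum of
  the chosen times.\<close>

section \<open>Orbits visiting open sets\<close>

text \<open>The times that realise a limit point in \<open>U\<close> tend to infinity, so they
  eventually exceed \<open>m\<close>. The orbit must stay in \<open>X\<close> because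
  \<open>U\<close> is open only relative to \<open>X\<close>.\<close>

lemma omega_limit_visits:
  assumes "omega_limit x T = X" "openin (top_of_set X) U" "U \<noteq> {}" "\<And>k. (T ^^ k) x \<in> X"
  shows "\<exists>k\<ge>m. (T ^^ k) x \<in> U"
proof -
  obtain O' where O: "open O'" "U = X \<inter> O'"
    using assms(2) by (auto simp: openin_open)
  obtain y where y: "y \<in> U" using assms(3) by auto
  then have "y \<in> omega_limit x T" using O assms(1) by auto
  then obtain k :: "nat \<Rightarrow> nat" where k: "filterlim k at_top sequentially"
      "(\<lambda>i. (T ^^ k i) x) \<longlonglongrightarrow> y"
    by (auto simp: omega_limit_def)
  have "eventually (\<lambda>i. k i \<ge> m) sequentially"
    using k(1) by (auto simp: filterlim_at_top)
  moreover have "eventually (\<lambda>i. (T ^^ k i) x \<in> O') sequentially"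
    using topological_tendstoD[OF k(2)] O y by auto
  ultimately have "eventually (\<lambda>i. k i \<ge> m \<and> (T ^^ k i) x \<in> O') sequentially"
    by eventually_elim auto
  then obtain i where "k i \<ge> m" "(T ^^ k i) x \<in> O'"
    using eventually_sequentially by auto
  then show ?thesis using O assms(4) by auto
qed

lemma funpow_map_prod:
  fixes f :: "'a \<Rightarrow> 'a" and g :: "'b \<Rightarrow> 'b"
  shows "(map_prod f g ^^ k) (x, y) = ((f ^^ k) x, (g ^^ k) y)"
  by (induction k) auto

locale weakly_mixing_system =
  fixes X :: "'a::metric_space set" and T :: "'a \<Rightarrow> 'a"
  assumes system: "dynamical_system X T" and mixing: "weakly_mixing X T"
begin

abbreviation nonempty_open :: "'a set \<Rightarrow> bool" where
  "nonempty_open U \<equiv> openin (top_of_set X) U \<and> U \<noteq> {}"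

abbreviation pre :: "nat \<Rightarrow> 'a set \<Rightarrow> 'a set" where
  "pre k U \<equiv> X \<inter> (T ^^ k) -` U"

lemma compact_X: "compact X"
  using system by (simp add: dynamical_system_def)

lemma funpow_in: "x \<in> X \<Longrightarrow> (T ^^ k) x \<in> X"
  using system by (induction k) (auto simp: dynamical_system_def)

lemma continuous_on_funpow: "continuous_on X (T ^^ k)"
proof (induction k)
  case (Suc k)
  moreover have "continuous_on ((T ^^ k) ` X) T"
    using system funpow_in
    by (auto simp: dynamical_system_def intro: continuous_on_subset)
  ultimately show ?case
    using continuous_on_compose by auto
qed (auto simp: id_def)

lemma openin_pre: "openin (top_of_set X) U \<Longrightarrow> openin (top_of_set X) (pre k U)"
  by (rule continuous_openin_preimage[OF continuous_on_funpow]) (auto simp: funpow_in)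

section \<open>Common return times of open sets\<close>

text \<open>A point of \<open>X \<times> X\<close> whose omega-limit set is the whole product visits
  \<open>A \<times> C\<close> and later \<open>B \<times> D\<close>; the time elapsed between the
  two visits works for both pairs.\<close>

lemma common_return_time_pair:
  assumes "nonempty_open A" "nonempty_open B" "nonempty_open C" "nonempty_open D"
  shows "\<exists>k\<ge>1. A \<inter> pre k B \<noteq> {} \<and> C \<inter> pre k D \<noteq> {}"
proof -
  obtain x y where xy: "x \<in> X" "y \<in> X" "omega_limit (x, y) (map_prod T T) = X \<times> X"
    using mixing by (auto simp: weakly_mixing_def transitive_system_def)
  have visits: "\<exists>k\<ge>m. (T ^^ k) x \<in> E \<and> (T ^^ k) y \<in> F"
    if "nonempty_open E" "nonempty_open F" for E F m
    using omega_limit_visits[OF xy(3), of "E \<times> F" m] that xy(1,2)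
    by (auto simp: funpow_map_prod funpow_in openin_Times)
  obtain i where i: "(T ^^ i) x \<in> A" "(T ^^ i) y \<in> C"
    using visits[of A C] assms by auto
  \<comment> \<open>Starting the search at \<open>Suc i\<close> makes \<open>j - i\<close>
    positive.\<close>
  obtain j where j: "j \<ge> Suc i" "(T ^^ j) x \<in> B" "(T ^^ j) y \<in> D"
    using visits[of B D "Suc i"] assms by auto
  have eq: "(T ^^ (j - i)) ((T ^^ i) z) = (T ^^ j) z" for z
    using j(1) by (metis Suc_leD comp_apply funpow_add le_add_diff_inverse2)
  then have "(T ^^ i) x \<in> A \<inter> pre (j - i) B" "(T ^^ i) y \<in> C \<inter> pre (j - i) D"
    using i j xy funpow_in by auto
  then show ?thesis
    using j(1) by (intro exI[of _ "j - i"]) auto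
qed

text \<open>Powers of \<open>T\<close> commute: if \<open>T ^^ m\<close> moves \<open>x\<close> into
  \<open>C\<close> and \<open>(T ^^ k) x\<close> into \<open>D\<close>, then \<open>T ^^ k\<close>
  moves \<open>(T ^^ m) x\<close> from \<open>C\<close> into \<open>D\<close>. Two pairs thus reduce
  to a single one, which is the induction step for finitely many pairs.\<close>

lemma Furstenberg_intersection:
  assumes "nonempty_open A" "nonempty_open B" "nonempty_open C" "nonempty_open D"
  shows "\<exists>E F. nonempty_open E \<and> nonempty_open F \<and>
    (\<forall>k. E \<inter> pre k F \<noteq> {} \<longrightarrow> A \<inter> pre k B \<noteq> {} \<and> C \<inter> pre k D \<noteq> {})"
proof -
  \<comment> \<open>The four sets are regrouped: \<open>m\<close> links the two sources
    \<open>A\<close>, \<open>C\<close> and the two targets \<open>B\<close>,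
    \<open>D\<close>.\<close>
  obtain m where m: "A \<inter> pre m C \<noteq> {}" "B \<inter> pre m D \<noteq> {}"
    using common_return_time_pair[of A C B D] assms by auto
  have "A \<inter> pre k B \<noteq> {} \<and> C \<inter> pre k D \<noteq> {}"
    if "(A \<inter> pre m C) \<inter> pre k (B \<inter> pre m D) \<noteq> {}" for k
  proof -
    obtain x where x: "x \<in> A" "x \<in> X" "(T ^^ m) x \<in> C" "(T ^^ k) x \<in> B" "(T ^^ m) ((T ^^ k) x) \<in> D"
      using \<open>(A \<inter> pre m C) \<inter> pre k (B \<inter> pre m D) \<noteq> {}\<close> by auto
    have "(T ^^ k) ((T ^^ m) x) = (T ^^ m) ((T ^^ k) x)"
      by (metis add.commute comp_apply funpow_add)
    then have "(T ^^ m) x \<in> C \<inter> pre k D" "x \<in> A \<inter> pre k B"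
      using x funpow_in by auto
    then show ?thesis by blast
  qed
  moreover have "nonempty_open (A \<inter> pre m C)" "nonempty_open (B \<inter> pre m D)"
    using m assms openin_pre by auto
  ultimately show ?thesis by blast
qed

lemma common_return_time:
  assumes "finite S" "\<And>A B. (A, B) \<in> S \<Longrightarrow> nonempty_open A \<and> nonempty_open B"
  shows "\<exists>k\<ge>1. \<forall>(A, B)\<in>S. A \<inter> pre k B \<noteq> {}"
proof -
  \<comment> \<open>The induction collapses \<open>S\<close> to one pair that controls all others; a
    return time is chosen only afterwards, for this pair.\<close>
  have "\<exists>E F. nonempty_open E \<and> nonempty_open F \<and>
      (\<forall>k. E \<inter> pre k F \<noteq> {} \<longrightarrow> (\<forall>(A, B)\<in>S. A \<inter> pre k B \<noteq> {}))"
    using assms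
  proof (induction S rule: finite_induct)
    case empty
    have "nonempty_open X"
      using mixing by (auto simp: weakly_mixing_def transitive_system_def)
    then show ?case by blast
  next
    case (insert AB S)
    obtain A B where AB: "AB = (A, B)" by fastforce
    obtain C D where CD: "nonempty_open C" "nonempty_open D"
        "\<forall>k. C \<inter> pre k D \<noteq> {} \<longrightarrow> (\<forall>(A, B)\<in>S. A \<inter> pre k B \<noteq> {})"
      using insert.IH insert.prems by (metis insertCI)
    have "nonempty_open A" "nonempty_open B"
      using insert.prems AB by auto
    from Furstenberg_intersection[OF this CD(1,2)] obtain E F where
        "nonempty_open E" "nonempty_open F"
        "\<forall>k. E \<inter> pre k F \<noteq> {} \<longrightarrow> A \<inter> pre k B \<noteq> {} \<and> C \<inter> pre k D \<noteq> {}"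
      by auto
    then show ?case
      using CD(3) AB by (intro exI[of _ E] exI[of _ F]) auto
  qed
  then obtain E F where EF: "nonempty_open E" "nonempty_open F"
      "\<forall>k. E \<inter> pre k F \<noteq> {} \<longrightarrow> (\<forall>(A, B)\<in>S. A \<inter> pre k B \<noteq> {})"
    by auto
  then obtain k where k: "k \<ge> 1" "E \<inter> pre k F \<noteq> {}"
    using common_return_time_pair[of E F E F] by auto
  then show ?thesis
    using mp[OF spec[OF EF(3)] k(2)] by (intro exI[of _ k] conjI)
qed

text \<open>In a finite metric space singletons are open, so some power of \<open>T\<close> would
  have to send \<open>a\<close> both to \<open>a\<close> and to \<open>b\<close>.\<close>

lemma infinite_space:
  assumes "\<not> is_singleton X"
  shows "infinite X"
proof
  assume fin: "finite X"
  have "nonempty_open {c}" if "c \<in> X" for c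
    using that finite_imp_closed[of "X - {c}"] fin
    by (auto simp: openin_open intro!: exI[of _ "- (X - {c})"])
  moreover have "X \<noteq> {}"
    using mixing by (auto simp: weakly_mixing_def transitive_system_def)
  then obtain a b where "a \<in> X" "b \<in> X" "a \<noteq> b"
    using assms by (metis is_singletonI')
  ultimately show False
    using common_return_time_pair[of "{a}" "{a}" "{a}" "{b}"] by auto
qed

section \<open>Successive return times and their finite sums\<close>

lemma return_times_construction:
  fixes W A\<^sub>0 :: "'i \<Rightarrow> 'a set"
  assumes "finite I" and W: "\<And>i. i \<in> I \<Longrightarrow> nonempty_open (W i)"
    and A\<^sub>0: "\<And>i. i \<in> I \<Longrightarrow> nonempty_open (A\<^sub>0 i)"
  obtains V A and p :: "nat \<Rightarrow> nat" where
    "V 0 = W" "A 0 = A\<^sub>0" "\<And>m. p m \<ge> 1"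
    "\<And>m i. i \<in> I \<Longrightarrow> nonempty_open (A m i)"
    "\<And>m i. i \<in> I \<Longrightarrow> V (Suc m) i = V m i \<inter> pre (p (Suc m)) (V m i)"
    "\<And>m i. i \<in> I \<Longrightarrow> A (Suc m) i = A m i \<inter> pre (p (Suc m)) (V m i)"
proof -
  \<comment> \<open>A state holds the time \<open>q\<close> that produced the current stage and the
    sets of that stage. At stage 0 the time is an arbitrary positive placeholder.\<close>
  define ok where "ok m s \<longleftrightarrow> (case s of (q, V, A) \<Rightarrow> q \<ge> (1::nat) \<and>
      (\<forall>i\<in>I. nonempty_open (V i) \<and> nonempty_open (A i)) \<and> (m = 0 \<longrightarrow> V = W \<and> A = A\<^sub>0))"
    for m :: nat and s
  define step where "step s s' \<longleftrightarrow> (case (s, s') of ((_, V, A), (q, V', A')) \<Rightarrow>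
      \<forall>i\<in>I. V' i = V i \<inter> pre q (V i) \<and> A' i = A i \<inter> pre q (V i))"
    for s s' :: "nat \<times> ('i \<Rightarrow> 'a set) \<times> ('i \<Rightarrow> 'a set)"
  have "\<exists>f. \<forall>m. ok m (f m) \<and> step (f m) (f (Suc m))"
  proof (rule dependent_nat_choice)
    show "\<exists>s. ok 0 s"
      using W A\<^sub>0 by (auto simp: ok_def)
  next
    fix s m
    assume ok: "ok m s"
    obtain q V A where s: "s = (q, V, A)" by (cases s) auto
    \<comment> \<open>One time for all these pairs keeps every new \<open>V i\<close> and every new
      \<open>A i\<close> non-empty.\<close>
    let ?S = "(\<lambda>i. (V i, V i)) ` I \<union> (\<lambda>i. (A i, V i)) ` I"
    have "\<exists>k\<ge>1. \<forall>(A, B)\<in>?S. A \<inter> pre k B \<noteq> {}"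
      by (rule common_return_time) (use ok s assms(1) in \<open>auto simp: ok_def\<close>)
    then obtain k where k: "k \<ge> 1" "\<forall>(A, B)\<in>?S. A \<inter> pre k B \<noteq> {}"
      by blast
    have "V i \<inter> pre k (V i) \<noteq> {}" "A i \<inter> pre k (V i) \<noteq> {}" if "i \<in> I" for i
      using k(2) that by (simp_all add: ball_Un)
    moreover have "openin (top_of_set X) (V i \<inter> pre k (V i))"
        "openin (top_of_set X) (A i \<inter> pre k (V i))" if "i \<in> I" for i
      using ok s that openin_pre by (auto simp: ok_def)
    ultimately have "ok (Suc m) (k, \<lambda>i. V i \<inter> pre k (V i), \<lambda>i. A i \<inter> pre k (V i))"
      using k(1) by (simp add: ok_def)
    moreover have "step s (k, \<lambda>i. V i \<inter> pre k (V i), \<lambda>i. A i \<inter> pre k (V i))"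
      by (simp add: s step_def)
    ultimately show "\<exists>s'. ok (Suc m) s' \<and> step s s'" by blast
  qed
  then obtain f where f: "\<And>m. ok m (f m)" "\<And>m. step (f m) (f (Suc m))"
    by blast
  show thesis
  proof (rule that)
    show "(fst \<circ> snd \<circ> f) 0 = W" "(snd \<circ> snd \<circ> f) 0 = A\<^sub>0"
      using f(1)[of 0] by (auto simp: ok_def split: prod.splits)
    show "(fst \<circ> f) m \<ge> 1" "i \<in> I \<Longrightarrow> nonempty_open ((snd \<circ> snd \<circ> f) m i)" for m i
      using f(1)[of m] by (auto simp: ok_def split: prod.splits)
    show "(fst \<circ> snd \<circ> f) (Suc m) i =
        (fst \<circ> snd \<circ> f) m i \<inter> pre ((fst \<circ> f) (Suc m)) ((fst \<circ> snd \<circ> f) m i)"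
      "(snd \<circ> snd \<circ> f) (Suc m) i =
        (snd \<circ> snd \<circ> f) m i \<inter> pre ((fst \<circ> f) (Suc m)) ((fst \<circ> snd \<circ> f) m i)"
      if "i \<in> I" for m i
      using f(2)[of m] that by (auto simp: step_def split: prod.splits)
  qed
qed

text \<open>Compactness yields a point in all closures of the decreasing sets \<open>A m i\<close>.
  The sets themselves may have empty intersection, hence the closures in the conclusion.\<close>

lemma finite_sums_into_closure:
  fixes W A\<^sub>0 :: "'i \<Rightarrow> 'a set"
  assumes "finite I" and W: "\<And>i. i \<in> I \<Longrightarrow> nonempty_open (W i)"
    and A\<^sub>0: "\<And>i. i \<in> I \<Longrightarrow> nonempty_open (A\<^sub>0 i)"
  shows "\<exists>p :: nat \<Rightarrow> nat. (\<forall>m. p m \<ge> 1) \<and> (\<exists>x. \<forall>i\<in>I. x i \<in> closure (A\<^sub>0 i) \<and>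
      (\<forall>\<alpha>. finite \<alpha> \<and> \<alpha> \<noteq> {} \<and> \<alpha> \<subseteq> {1..} \<longrightarrow> (T ^^ sum p \<alpha>) (x i) \<in> closure (W i)))"
proof -
  obtain V A p where 0: "V 0 = W" "A 0 = A\<^sub>0" and p: "\<And>m. p m \<ge> 1"
    and A: "\<And>m i. i \<in> I \<Longrightarrow> nonempty_open (A m i)"
    and V_Suc: "\<And>m i. i \<in> I \<Longrightarrow> V (Suc m) i = V m i \<inter> pre (p (Suc m)) (V m i)"
    and A_Suc: "\<And>m i. i \<in> I \<Longrightarrow> A (Suc m) i = A m i \<inter> pre (p (Suc m)) (V m i)"
    by (rule return_times_construction[of I W A\<^sub>0]) (assumption | rule assms | rule that)+
  \<comment> \<open>The time with the largest index is applied first; it lowers the stage by one and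
    leaves a sum over smaller indices.\<close>
  have split_sum: "(T ^^ sum p \<alpha>) x = (T ^^ sum p (\<alpha> - {Suc m})) ((T ^^ p (Suc m)) x)"
    "\<alpha> - {Suc m} \<subseteq> {1..m}" if "\<alpha> \<subseteq> {1..Suc m}" "Suc m \<in> \<alpha>" for \<alpha> m x
  proof -
    have "sum p \<alpha> = sum p (\<alpha> - {Suc m}) + p (Suc m)"
      using that by (metis add.commute finite_atLeastAtMost finite_subset sum.remove)
    then show "(T ^^ sum p \<alpha>) x = (T ^^ sum p (\<alpha> - {Suc m})) ((T ^^ p (Suc m)) x)"
      by (simp add: funpow_add)
    show "\<alpha> - {Suc m} \<subseteq> {1..m}"
      using that by (auto simp: le_Suc_eq)
  qed
  have V_sum: "(T ^^ sum p \<alpha>) x \<in> W i" if "i \<in> I" "x \<in> V m i" "\<alpha> \<subseteq> {1..m}" for i x m \<alpha>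
    using that(2,3)
  proof (induction m arbitrary: x \<alpha>)
    case (Suc m)
    show ?case
    proof (cases "Suc m \<in> \<alpha>")
      case True
      then show ?thesis
        using Suc.IH[of "(T ^^ p (Suc m)) x" "\<alpha> - {Suc m}"] Suc.prems split_sum(1)[of \<alpha> m x]
          split_sum(2)[of \<alpha> m] V_Suc[OF that(1)] by auto
    next
      case False
      then have "\<alpha> \<subseteq> {1..m}"
        using Suc.prems by (force simp: le_Suc_eq)
      then show ?thesis
        using Suc V_Suc[OF that(1)] by auto
    qed
  qed (simp add: 0)
  \<comment> \<open>The largest index of \<open>\<alpha>\<close> moves the point from an
    \<open>A\<close> set into a \<open>V\<close> set, after which \<open>V_sum\<close> takes over.
    Unlike there, \<open>\<alpha>\<close> must be non-empty, since \<open>A 0 i\<close> need not lie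
    in \<open>W i\<close>.\<close>
  have A_sum: "(T ^^ sum p \<alpha>) x \<in> W i"
    if "i \<in> I" "x \<in> A m i" "\<alpha> \<subseteq> {1..m}" "\<alpha> \<noteq> {}" for i x m \<alpha>
    using that(2,3)
  proof (induction m)
    case (Suc m)
    show ?case
    proof (cases "Suc m \<in> \<alpha>")
      case True
      then show ?thesis
        using V_sum[of i "(T ^^ p (Suc m)) x" m "\<alpha> - {Suc m}"] Suc.prems split_sum(1)[of \<alpha> m x]
          split_sum(2)[of \<alpha> m] A_Suc[OF that(1)] that(1) by auto
    next
      case False
      then have "\<alpha> \<subseteq> {1..m}"
        using Suc.prems by (force simp: le_Suc_eq)
      then show ?thesis
        using Suc A_Suc[OF that(1)] by auto
    qed
  qed (use that(4) in simp)
  \<comment> \<open>Continuity of the powers of \<open>T\<close> is known only on \<open>X\<close>,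
    so the closures must stay inside it.\<close>
  have closure_X: "closure (A m i) \<subseteq> X" if "i \<in> I" for m i
    using A[OF that, of m] compact_X by (meson closure_minimal compact_imp_closed openin_imp_subset)
  have "\<exists>x. \<forall>m. x \<in> closure (A m i)" if "i \<in> I" for i
  proof -
    have decreasing: "A m' i \<subseteq> A m i" if "m \<le> m'" for m m'
      using that by (rule lift_Suc_antimono_le[rotated]) (use A_Suc[OF \<open>i \<in> I\<close>] in auto)
    have "X \<inter> (\<Inter>m\<in>UNIV. closure (A m i)) \<noteq> {}"
    proof (rule compact_imp_fip_image[OF compact_X])
      fix M :: "nat set"
      assume "finite M"
      \<comment> \<open>By monotonicity the set with the largest index lies in all the others;
        inserting 0 keeps \<open>Max\<close> meaningful for empty \<open>M\<close>.\<close>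
      obtain x where "x \<in> A (Max (insert 0 M)) i"
        using A[OF \<open>i \<in> I\<close>] by blast
      moreover have "A (Max (insert 0 M)) i \<subseteq> A m i" if "m \<in> M" for m
        using \<open>finite M\<close> that by (intro decreasing Max_ge) auto
      ultimately have "x \<in> closure (A m i)" if "m \<in> M" for m
        using that closure_subset by blast
      moreover have "x \<in> X"
        using \<open>x \<in> A (Max (insert 0 M)) i\<close> closure_X[OF that] closure_subset by blast
      ultimately show "X \<inter> (\<Inter>m\<in>M. closure (A m i)) \<noteq> {}"
        by blast
    qed simp
    then show ?thesis by auto
  qed
  then obtain x where x: "\<And>i m. i \<in> I \<Longrightarrow> x i \<in> closure (A m i)"
    by metis
  have "(T ^^ sum p \<alpha>) (x i) \<in> closure (W i)"
    if "i \<in> I" "finite \<alpha>" "\<alpha> \<noteq> {}" "\<alpha> \<subseteq> {1..}" for i \<alpha>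
  proof -
    \<comment> \<open>Stage \<open>Max \<alpha>\<close> already decides this sum, and continuity
      carries the inclusion over to the closure.\<close>
    have "\<alpha> \<subseteq> {1..Max \<alpha>}"
      using that by auto
    then have "(T ^^ sum p \<alpha>) ` A (Max \<alpha>) i \<subseteq> closure (W i)"
      using A_sum[of i _ "Max \<alpha>" \<alpha>] that closure_subset[of "W i"] by blast
    then have "(T ^^ sum p \<alpha>) ` closure (A (Max \<alpha>) i) \<subseteq> closure (W i)"
      by (intro image_closure_subset continuous_on_subset[OF continuous_on_funpow closure_X] that(1))
        auto
    then show ?thesis
      using x[OF that(1)] by auto
  qed
  then show ?thesis
    using p x[of _ 0] 0 by (intro exI[of _ p] conjI exI[of _ x]) auto
qed

section \<open>Sensitivity from separated target points\<close>

lemma tuplewise_IP_sensitive: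
  assumes "\<not> is_singleton X" "n \<ge> 2"
  shows "tuplewise_IP_sensitive n X T"
proof -
  define P where "P = {(i, j). 1 \<le> i \<and> i < j \<and> j \<le> n}"
  have "finite P"
    by (rule finite_subset[of _ "{1..n} \<times> {1..n}"]) (auto simp: P_def)
  \<comment> \<open>Here \<open>n \<ge> 2\<close> ensures that the minima range over a non-empty
    set.\<close>
  have "(1, 2) \<in> P"
    using assms(2) by (simp add: P_def)
  then have P_nonempty: "P \<noteq> {}"
    by blast
  have Min_set: "{dist (f i) (f j) | i j. 1 \<le> i \<and> i < j \<and> j \<le> n} = (\<lambda>(i, j). dist (f i) (f j)) ` P"
    for f :: "nat \<Rightarrow> 'a"
    by (auto simp: P_def)
  obtain Z where Z: "Z \<subseteq> X" "finite Z" "card Z = n"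
    using infinite_arbitrarily_large[OF infinite_space[OF assms(1)]] by blast
  obtain z where z: "bij_betw z {1..n} Z"
    using Z by (metis bij_betw_iff_card card_atLeastAtMost diff_Suc_1 finite_atLeastAtMost)
  \<comment> \<open>The least distance between the chosen points fixes the constant
    \<open>e / 3\<close> before any \<open>U\<close> is given.\<close>
  define e where "e = Min ((\<lambda>(i, j). dist (z i) (z j)) ` P)"
  have "z i \<noteq> z j" if "(i, j) \<in> P" for i j
    using that bij_betw_imp_inj_on[OF z] by (force simp: P_def inj_on_def)
  then have "e > 0"
    unfolding e_def using \<open>finite P\<close> P_nonempty by auto
  have e_le: "e \<le> dist (z i) (z j)" if "(i, j) \<in> P" for i j
    unfolding e_def using \<open>finite P\<close> that by (intro Min_le) auto
  define W where "W i = X \<inter> ball (z i) (e / 4)" for i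
  have W: "nonempty_open (W i)" if "i \<in> {1..n}" for i
  proof -
    have "z i \<in> W i"
      using that Z z \<open>e > 0\<close> by (auto simp: W_def bij_betw_def)
    then show ?thesis
      by (auto simp: W_def)
  qed
  have closure_W: "closure (W i) \<subseteq> cball (z i) (e / 4)" for i
    by (rule closure_minimal) (auto simp: W_def)
  have "\<exists>x. (\<forall>i\<in>{1..n}. x i \<in> U) \<and> IP_set {k. k \<ge> 1 \<and>
      Min {dist ((T ^^ k) (x i)) ((T ^^ k) (x j)) | i j. 1 \<le> i \<and> i < j \<and> j \<le> n} > e / 3}"
    if "nonempty_open U" for U
  proof -
    obtain u where "u \<in> U" using \<open>nonempty_open U\<close> by blast
    then have "u \<in> X" "\<exists>r>0. X \<inter> cball u r \<subseteq> U"
      using \<open>nonempty_open U\<close> by (auto simp: openin_contains_cball Int_commute)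
    then obtain r where r: "r > 0" "X \<inter> cball u r \<subseteq> U"
      by blast
    \<comment> \<open>The points found lie only in the closure of \<open>A\<close>, so the closed
      ball of the same radius was placed inside \<open>U\<close>.\<close>
    define A where "A = X \<inter> ball u r"
    have "u \<in> A"
      using r \<open>u \<in> X\<close> by (simp add: A_def)
    then have "nonempty_open A"
      by (auto simp: A_def)
    then obtain p :: "nat \<Rightarrow> nat" and x where p: "\<And>m. p m \<ge> 1"
      and x: "\<And>i. i \<in> {1..n} \<Longrightarrow> x i \<in> closure A"
      and sums: "\<And>i \<alpha>. i \<in> {1..n} \<Longrightarrow> finite \<alpha> \<Longrightarrow> \<alpha> \<noteq> {} \<Longrightarrow> \<alpha> \<subseteq> {1..} \<Longrightarrow>
        (T ^^ sum p \<alpha>) (x i) \<in> closure (W i)"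
      using finite_sums_into_closure[of "{1..n}" W "\<lambda>_. A"] W by (metis finite_atLeastAtMost)
    have "closure A \<subseteq> X \<inter> cball u r"
      by (rule closure_minimal) (auto simp: A_def closed_Int compact_imp_closed compact_X)
    then have "x i \<in> U" if "i \<in> {1..n}" for i
      using x[OF that] r by auto
    moreover have "sum p \<alpha> \<ge> 1 \<and> Min {dist ((T ^^ sum p \<alpha>) (x i)) ((T ^^ sum p \<alpha>) (x j)) | i j.
        1 \<le> i \<and> i < j \<and> j \<le> n} > e / 3"
      if \<alpha>: "finite \<alpha>" "\<alpha> \<noteq> {}" "\<alpha> \<subseteq> {1..}" for \<alpha>
    proof
      obtain a where "a \<in> \<alpha>" using \<alpha> by auto
      then show "sum p \<alpha> \<ge> 1"
        using p[of a] member_le_sum[of a \<alpha> p] \<alpha> by auto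
      have "dist ((T ^^ sum p \<alpha>) (x i)) ((T ^^ sum p \<alpha>) (x j)) > e / 3" if "(i, j) \<in> P" for i j
      proof -
        let ?y = "\<lambda>i. (T ^^ sum p \<alpha>) (x i)"
        have "dist (z i) (?y i) \<le> e / 4" "dist (z j) (?y j) \<le> e / 4"
          using sums[of i \<alpha>] sums[of j \<alpha>] closure_W[of i] closure_W[of j] \<alpha> that
          by (auto simp: P_def)
        \<comment> \<open>Both images are within \<open>e / 4\<close> of their targets, which leaves
          a distance of at least \<open>e / 2\<close>, more than \<open>e / 3\<close>.\<close>
        moreover have "dist (z i) (z j) \<le> dist (z i) (?y i) + dist (?y i) (?y j) + dist (z j) (?y j)"
          using dist_triangle[of "z i" "z j" "?y i"] dist_triangle[of "?y i" "z j" "?y j"]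
          by (simp add: dist_commute)
        ultimately show ?thesis
          using e_le[OF that] \<open>e > 0\<close> by linarith
      qed
      then show "Min {dist ((T ^^ sum p \<alpha>) (x i)) ((T ^^ sum p \<alpha>) (x j)) | i j.
          1 \<le> i \<and> i < j \<and> j \<le> n} > e / 3"
        unfolding Min_set[of "\<lambda>i. (T ^^ sum p \<alpha>) (x i)"]
        using \<open>finite P\<close> P_nonempty by (subst Min_gr_iff) auto
    qed
    ultimately show ?thesis
      unfolding IP_set_def using p by (intro exI[of _ x] conjI exI[of _ p]) auto
  qed
  then show ?thesis
    unfolding tuplewise_IP_sensitive_def using \<open>e > 0\<close> by (intro exI[of _ "e / 3"]) auto
qed

end

theorem theorem3p2:
  fixes X :: "'a::metric_space set" and T :: "'a \<Rightarrow> 'a"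
  assumes "dynamical_system X T"
    and "\<not> is_singleton X"
    and "weakly_mixing X T"
  shows "\<forall>n\<ge>2. tuplewise_IP_sensitive n X T"
proof -
  interpret weakly_mixing_system X T
    by standard (rule assms)+
  show ?thesis
    using tuplewise_IP_sensitive assms(2) by blast
qed

end
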